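(* Let $F$ be an arbitrary quasinorm on $D(e)=\mathrm{span}(X,Y)\cong\mathbb{R}^2$. An abnormal extremal $(x,y,z,v,w)(t)$, $t\in\mathbb{R}$, on the Cartan group starting at the unit (at $t=0$) is one of the following one-parameter subgroups: $$x(t)\equiv 0,\quad y(t)=\frac{st}{F(0,s)},\quad s=\pm1,\quad z(t)=v(t)=w(t)\equiv 0;$$ $$x(t)=\frac{st}{F(s,0)},\quad s=\pm 1,\quad y(t)=z(t)=v(t)=w(t)\equiv 0;$$ $$x(t)=\frac{s\varphi_5 t}{F(s\varphi_5,-s\varphi_4)},\quad y(t)=\frac{-\varphi_4x(t)}{\varphi_5},\quad s=\pm1,\quad z(t)=v(t)=w(t)\equiv 0,\quad \varphi_4\cdot\varphi_5\neq 0,$$ where $\varphi_4=\psi_4(0)$, $\varphi_5=\psi_5(0)$; and it is not strongly abnormal.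
   Context: The Cartan algebra is the 5-dimensional real Lie algebra with basis $X,Y,Z,V,W$ and $[X,Y]=Z$, $[X,Z]=V$, $[Y,Z]=W$, all other brackets of basis elements zero. The Cartan group $G$ is the connected simply connected Lie group with this Lie algebra, identified with $\mathbb{R}^5$ via $(x,y,z,v,w)\leftrightarrow\exp(xX+yY+zZ+vV+wW)$ (the unit is $0$). A quasinorm $F:\mathbb{R}^2\to[0,\infty)$ satisfies $F(u)=0$ iff $u=0$, $F(\lambda u)=\lambda F(u)$ for $\lambda\ge0$, $F(u+u')\le F(u)+F(u')$ (symmetry is not required); here $u_1X+u_2Y$ is identified with $(u_1,u_2)$, and $U=\{u\in\mathbb{R}^2: F(u)\le1\}$. The left-invariant sub-Finsler quasimetric on $G$ defined by $F$ has as its shortest arcs the time-optimal solutions of the control system $\dot g=u_1X(g)+u_2Y(g)$ with measurable controls $u(t)=(u_1(t),u_2(t))\in U$; in coordinates $$\dot x=u_1,\quad \dot y=u_2,\quad \dot z=\tfrac12(xu_2-yu_1),$$ $$\dot v=-\tfrac12\left(z+\tfrac16xy\right)u_1+\tfrac1{12}x^2u_2,\quad \dot w=-\tfrac1{12}y^2u_1-\tfrac12\left(z-\tfrac16xy\right)u_2 .$$ Trajectories are the absolutely continuous solutions of this system. For a covector $\psi=(\psi_1,\dots,\psi_5)$ at $(x,y,z,v,w)$ (components relative to $\partial_x,\partial_y,\partial_z,\partial_v,\partial_w$) put $$h_1=\psi(X)=\psi_1-\tfrac12\psi_3y-\tfrac1{12}\psi_4xy-\tfrac1{12}\psi_5y^2-\tfrac12\psi_4z,$$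 $$h_2=\psi(Y)=\psi_2+\tfrac12\psi_3x+\tfrac1{12}\psi_4x^2+\tfrac1{12}\psi_5xy-\tfrac12\psi_5z,$$ and $\mathcal H=h_1u_1+h_2u_2$. A trajectory $g(t)=(x,y,z,v,w)(t)$, $t\in\mathbb{R}$, with control $u(t)$ satisfies the Pontryagin Maximum Principle (for the time-optimal problem) with $\psi(t)$ if $\psi(t)$ is absolutely continuous, non-vanishing, solves $\dot\psi=-\partial\mathcal H/\partial(x,y,z,v,w)$ a.e., and for a.e. $t$ $$M(t)=h_1(t)u_1(t)+h_2(t)u_2(t)=\max_{u\in U}\bigl(h_1(t)u_1+h_2(t)u_2\bigr)\equiv M\ge0 .$$ An extremal is a curve satisfying the Pontryagin Maximum Principle with some $\psi$. It is called abnormal (for this $\psi$) if $M=0$ and normal if $M>0$. An abnormal extremal is not strongly abnormal if it is also normal relative to some other covector function, i.e. satisfies the Pontryagin Maximum Principle with a covector function for which $M>0$.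
   Formalization: The extremal is additionally assumed to have unit speed (F(u(t)) = 1 for a.e. t) and to be locally injective in t; without this, the constant curve at the unit, or a curve reversing direction along a one-parameter subgroup, is a counterexample. *)

theory Defs
  imports "HOL-Analysis.Analysis"
begin

section \<open>The Cartan group in exponential coordinates\<close>

text \<open>A tuple \<open>(x, y, z, v, w)\<close> stands for \<open>x X + y Y + z Z + v V + w W\<close>
  in the Lie algebra and for the exponential of this element in the group.\<close>

type_synonym R2 = "real \<times> real"
type_synonym R5 = "real \<times> real \<times> real \<times> real \<times> real"

fun cartan_bracket :: "R5 \<Rightarrow> R5 \<Rightarrow> R5" where
  "cartan_bracket (x, y, z, v, w) (x', y', z', v', w') =
     (0, 0, x * y' - y * x', x * z' - z * x', y * z' - z * y')"

text \<open>The Baker--Campbell--Hausdorff series stops after the third-order terms,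
  since the algebra is nilpotent of step 3.\<close>

definition cartan_mult :: "R5 \<Rightarrow> R5 \<Rightarrow> R5" where
  "cartan_mult a b = a + b + (1/2) *\<^sub>R cartan_bracket a b
     + (1/12) *\<^sub>R cartan_bracket a (cartan_bracket a b)
     + (1/12) *\<^sub>R cartan_bracket b (cartan_bracket b a)"

definition one_parameter_subgroup :: "(real \<Rightarrow> R5) \<Rightarrow> bool" where
  "one_parameter_subgroup g \<longleftrightarrow>
     continuous_on UNIV g \<and> (\<forall>s t. g (s + t) = cartan_mult (g s) (g t))"

fun field_X :: "R5 \<Rightarrow> R5" where
  "field_X (x, y, z, v, w) = (1, 0, - y / 2, - (z + x * y / 6) / 2, - y\<^sup>2 / 12)"

fun field_Y :: "R5 \<Rightarrow> R5" where
  "field_Y (x, y, z, v, w) = (0, 1, x / 2, x\<^sup>2 / 12, - (z - x * y / 6) / 2)"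

lemma cartan_mult_assoc:
  "cartan_mult (cartan_mult a b) c = cartan_mult a (cartan_mult b c)"
  by (cases a, cases b, cases c) (simp add: cartan_mult_def field_simps)

lemma field_X_left_invariant:
  "((\<lambda>s. cartan_mult q (s, 0, 0, 0, 0)) has_vector_derivative field_X q) (at 0)"
proof (cases q)
  case (fields x y z v w)
  show ?thesis
    unfolding fields cartan_mult_def has_vector_derivative_def
    by (auto intro!: derivative_eq_intros simp: fun_eq_iff field_simps power2_eq_square)
qed

lemma field_Y_left_invariant:
  "((\<lambda>s. cartan_mult q (0, s, 0, 0, 0)) has_vector_derivative field_Y q) (at 0)"
proof (cases q)
  case (fields x y z v w)
  show ?thesis
    unfolding fields cartan_mult_def has_vector_derivative_def
    by (auto intro!: derivative_eq_intros simp: fun_eq_iff field_simps power2_eq_square)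
qed


section \<open>Quasinorms\<close>

definition quasinorm :: "(R2 \<Rightarrow> real) \<Rightarrow> bool" where
  "quasinorm F \<longleftrightarrow>
     (\<forall>u. F u \<ge> 0) \<and> (\<forall>u. F u = 0 \<longleftrightarrow> u = 0) \<and>
     (\<forall>c u. c \<ge> 0 \<longrightarrow> F (c *\<^sub>R u) = c * F u) \<and>
     (\<forall>u u'. F (u + u') \<le> F u + F u')"

definition unit_body :: "(R2 \<Rightarrow> real) \<Rightarrow> R2 set" where
  "unit_body F = {u. F u \<le> 1}"


section \<open>Trajectories\<close>

definition abs_continuous_on :: "real \<Rightarrow> real \<Rightarrow> (real \<Rightarrow> 'a::real_normed_vector) \<Rightarrow> bool" where
  "abs_continuous_on a b f \<longleftrightarrow>
     (\<forall>\<epsilon>>0. \<exists>\<delta>>0. \<forall>P :: (real \<times> real) set.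
        finite P \<and> (\<forall>(s, t)\<in>P. a \<le> s \<and> s \<le> t \<and> t \<le> b) \<and>
        disjoint_family_on (\<lambda>(s, t). {s<..<t}) P \<and> (\<Sum>(s, t)\<in>P. t - s) < \<delta>
        \<longrightarrow> (\<Sum>(s, t)\<in>P. norm (f t - f s)) < \<epsilon>)"

text \<open>On the whole line absolute continuity is understood on compact intervals.\<close>

definition abs_continuous :: "(real \<Rightarrow> 'a::real_normed_vector) \<Rightarrow> bool" where
  "abs_continuous f \<longleftrightarrow> (\<forall>a b. abs_continuous_on a b f)"

definition trajectory :: "(R2 \<Rightarrow> real) \<Rightarrow> (real \<Rightarrow> R5) \<Rightarrow> (real \<Rightarrow> R2) \<Rightarrow> bool" where
  "trajectory F g u \<longleftrightarrow>
     u \<in> borel_measurable lebesgue \<and> (\<forall>t. u t \<in> unit_body F) \<and> abs_continuous g \<and>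
     (AE t in lebesgue. (g has_vector_derivative
        fst (u t) *\<^sub>R field_X (g t) + snd (u t) *\<^sub>R field_Y (g t)) (at t))"


section \<open>The Pontryagin maximum principle\<close>

text \<open>A covector is given by its components relative to the coordinate basis, so its
  value on a tangent vector is the inner product with that vector.\<close>

definition hamiltonian :: "R5 \<Rightarrow> R5 \<Rightarrow> R2 \<Rightarrow> real" where
  "hamiltonian p q u = (p \<bullet> field_X q) * fst u + (p \<bullet> field_Y q) * snd u"

lemma inner_field_X:
  "(p1, p2, p3, p4, p5) \<bullet> field_X (x, y, z, v, w) =
     p1 - p3 * y / 2 - p4 * x * y / 12 - p5 * y\<^sup>2 / 12 - p4 * z / 2"
  by (simp add: field_simps)

lemma inner_field_Y:
  "(p1, p2, p3, p4, p5) \<bullet> field_Y (x, y, z, v, w) =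
     p2 + p3 * x / 2 + p4 * x\<^sup>2 / 12 + p5 * x * y / 12 - p5 * z / 2"
  by (simp add: field_simps)

definition pontryagin ::
  "(R2 \<Rightarrow> real) \<Rightarrow> (real \<Rightarrow> R5) \<Rightarrow> (real \<Rightarrow> R2) \<Rightarrow> (real \<Rightarrow> R5) \<Rightarrow> real \<Rightarrow> bool" where
  "pontryagin F g u \<psi> M \<longleftrightarrow>
     trajectory F g u \<and> abs_continuous \<psi> \<and> (\<forall>t. \<psi> t \<noteq> 0) \<and>
     (AE t in lebesgue. \<exists>D. GDERIV (\<lambda>q. hamiltonian (\<psi> t) q (u t)) (g t) :> D \<and>
        (\<psi> has_vector_derivative - D) (at t)) \<and>
     M \<ge> 0 \<and>
     (AE t in lebesgue. hamiltonian (\<psi> t) (g t) (u t) = M \<and>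
        (\<forall>u'\<in>unit_body F. hamiltonian (\<psi> t) (g t) u' \<le> M))"

definition abnormal_extremal ::
  "(R2 \<Rightarrow> real) \<Rightarrow> (real \<Rightarrow> R5) \<Rightarrow> (real \<Rightarrow> R2) \<Rightarrow> (real \<Rightarrow> R5) \<Rightarrow> bool" where
  "abnormal_extremal F g u \<psi> \<longleftrightarrow> pontryagin F g u \<psi> 0"

definition normal_extremal ::
  "(R2 \<Rightarrow> real) \<Rightarrow> (real \<Rightarrow> R5) \<Rightarrow> (real \<Rightarrow> R2) \<Rightarrow> (real \<Rightarrow> R5) \<Rightarrow> bool" where
  "normal_extremal F g u \<psi> \<longleftrightarrow> (\<exists>M>0. pontryagin F g u \<psi> M)"

definition strongly_abnormal ::
  "(R2 \<Rightarrow> real) \<Rightarrow> (real \<Rightarrow> R5) \<Rightarrow> (real \<Rightarrow> R2) \<Rightarrow> bool" where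
  "strongly_abnormal F g u \<longleftrightarrow>
     (\<exists>\<psi>. abnormal_extremal F g u \<psi>) \<and> \<not> (\<exists>\<psi>. normal_extremal F g u \<psi>)"


section \<open>Parametrization of extremals\<close>

definition arclength_parametrized :: "(R2 \<Rightarrow> real) \<Rightarrow> (real \<Rightarrow> R2) \<Rightarrow> bool" where
  "arclength_parametrized F u \<longleftrightarrow> (AE t in lebesgue. F (u t) = 1)"

text \<open>If \<open>M = 0\<close>, then \<open>\<psi>\<close> vanishes on \<open>X\<close> and \<open>Y\<close> along the curve and the maximum
  condition does not restrict the control. Unit speed therefore still admits curves that run
  back and forth along a one-parameter subgroup, switching between its two directions. Local
  injectivity excludes exactly these; every curve that is locally a shortest arc and every
  unit-speed curve with continuous control satisfies it.\<close>

definition locally_injective :: "(real \<Rightarrow> R5) \<Rightarrow> bool" where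
  "locally_injective g \<longleftrightarrow> (\<forall>t. \<exists>e>0. inj_on g {t - e<..<t + e})"

end

theory Submission
  imports Defs
begin

text \<open>For \<open>M = 0\<close> the maximum condition forces \<open>\<psi>\<close> to annihilate \<open>X\<close> and \<open>Y\<close> along the curve.
  Differentiating these two identities and using \<open>u \<noteq> 0\<close> shows that \<open>\<psi>\<close> annihilates \<open>Z = [X, Y]\<close>,
  and differentiating once more gives \<open>\<psi>\<^sub>4 u\<^sub>1 + \<psi>\<^sub>5 u\<^sub>2 = 0\<close> with constants
  \<open>(\<psi>\<^sub>4, \<psi>\<^sub>5) \<noteq> 0\<close>. The horizontal projection therefore runs along a line, local injectivity
  selects one direction on it, and unit speed determines the control. A linear functional supporting
  the unit body at this constant control, extended by zero, is a covector with \<open>M > 0\<close>.\<close>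

section \<open>The fundamental theorem of calculus for absolutely continuous functions\<close>

text \<open>Outer regularity gives an open \<open>T\<close> around \<open>E\<close> with
  \<open>T - E\<close> small; putting the null set \<open>E\<close> back leaves the measure
  unchanged.\<close>

lemma negligible_outer_open:
  fixes E :: "'a::euclidean_space set"
  assumes "negligible E" "0 < d"
  obtains T where "open T" "E \<subseteq> T" "T \<in> lmeasurable" "measure lebesgue T < d"
proof -
  have E: "E \<in> null_sets lebesgue"
    using assms(1) by (simp add: negligible_iff_null_sets)
  then have "E \<in> sets lebesgue" by auto
  then obtain T where T: "open T" "E \<subseteq> T" "T - E \<in> lmeasurable" "emeasure lebesgue (T - E) < ennreal d"
    using sets_lebesgue_outer_open[OF _ assms(2)] by metis
  have "T = (T - E) \<union> E" using T(2) by auto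
  then have meas: "T \<in> lmeasurable"
    using T(3) assms(1) by (metis fmeasurable.Un negligible_imp_measurable)
  have "emeasure lebesgue T = emeasure lebesgue (T - E)"
    using E T(1) by (simp add: emeasure_Diff_null_set)
  with T(4) have "emeasure lebesgue T < ennreal d" by simp
  then have "measure lebesgue T < d"
    using emeasure_eq_measure2[OF meas] ennreal_less_iff[of "measure lebesgue T" d] by simp
  with T(1,2) meas show ?thesis by (rule that)
qed

text \<open>On the tags in the exceptional set \<open>E\<close>, a gauge that confines the intervals to a small
  open superset of \<open>E\<close> lets absolute continuity bound the increments of \<open>f\<close>.\<close>

theorem abs_continuous_on_has_integral:
  fixes f :: "real \<Rightarrow> 'a::banach"
  assumes ac: "abs_continuous_on a b f" and "a \<le> b" and E: "negligible E"
    and der: "\<And>t. t \<in> {a..b} - E \<Longrightarrow> (f has_vector_derivative f' t) (at t within {a..b})"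
  shows "(f' has_integral (f b - f a)) {a..b}"
proof -
  \<comment> \<open>With \<open>h = 0\<close> on \<open>E\<close>, a tag in \<open>E\<close> adds
    nothing to the Riemann sum, and only the increment of \<open>f\<close> over its interval remains
    to be estimated.\<close>
  define h where "h t = (if t \<in> E then 0 else f' t)" for t
  have "(h has_integral (f b - f a)) {a..b}"
    unfolding has_integral_real
  proof (intro allI impI)
    fix e :: real assume "e > 0"
    \<comment> \<open>The summand 1 keeps the denominator positive when
      \<open>a = b\<close>.\<close>
    define e1 where "e1 = e / (2 * (b - a + 1))"
    have e1: "e1 > 0" "e1 * (b - a) < e / 2"
      using \<open>e > 0\<close> \<open>a \<le> b\<close> by (auto simp: e1_def field_simps)
    have "\<forall>x. \<exists>d>0. x \<in> {a..b} - E \<longrightarrow>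
         (\<forall>y\<in>{a..b}. norm (y-x) < d \<longrightarrow> norm (f y - f x - (y-x) *\<^sub>R h x) \<le> e1 * norm (y-x))"
    proof
      fix x
      show "\<exists>d>0. x \<in> {a..b} - E \<longrightarrow>
         (\<forall>y\<in>{a..b}. norm (y-x) < d \<longrightarrow> norm (f y - f x - (y-x) *\<^sub>R h x) \<le> e1 * norm (y-x))"
      proof (cases "x \<in> {a..b} - E")
        case True
        then have "h x = f' x" by (simp add: h_def)
        with der[OF True] e1(1) show ?thesis
          unfolding has_vector_derivative_def has_derivative_within_alt by auto
      next
        case False
        then show ?thesis by (auto intro: exI[of _ 1])
      qed
    qed
    then obtain d where d: "\<And>x. 0 < d x"
                 "\<And>x y. \<lbrakk>x \<in> {a..b} - E; y \<in> {a..b}; norm (y-x) < d x\<rbrakk>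
                        \<Longrightarrow> norm (f y - f x - (y-x) *\<^sub>R h x) \<le> e1 * norm (y-x)"
      by metis
    obtain \<delta> where "\<delta> > 0" and \<delta>: "\<And>P :: (real \<times> real) set.
        finite P \<Longrightarrow> (\<forall>(s, t)\<in>P. a \<le> s \<and> s \<le> t \<and> t \<le> b) \<Longrightarrow>
        disjoint_family_on (\<lambda>(s, t). {s<..<t}) P \<Longrightarrow> (\<Sum>(s, t)\<in>P. t - s) < \<delta> \<Longrightarrow>
        (\<Sum>(s, t)\<in>P. norm (f t - f s)) < e / 2"
      using ac[unfolded abs_continuous_on_def, rule_format, of "e / 2"] \<open>e > 0\<close> by auto
    obtain T where T: "open T" "E \<subseteq> T" "T \<in> lmeasurable" "measure lebesgue T < \<delta>"
      using negligible_outer_open[OF E \<open>\<delta> > 0\<close>] .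
    define \<gamma> where "\<gamma> x = (if x \<in> E then T else ball x (d x))" for x
    have "gauge \<gamma>"
      using T d(1) by (auto simp: gauge_def \<gamma>_def)
    moreover have "norm ((\<Sum>(x, K)\<in>p. measure lborel K *\<^sub>R h x) - (f b - f a)) < e"
      if ptag: "p tagged_division_of {a..b}" and fine: "\<gamma> fine p" for p
    proof -
      \<comment> \<open>Tags in \<open>E\<close> are controlled by absolute continuity, the others
        by the derivative; each group gets half of \<open>e\<close>.\<close>
      define p1 where "p1 = {(x, K) \<in> p. x \<in> E}"
      define p2 where "p2 = {(x, K) \<in> p. x \<notin> E}"
      have fin: "finite p" "finite p1" "finite p2" and p: "p = p1 \<union> p2" "p1 \<inter> p2 = {}"
        using tagged_division_of_finite[OF ptag] by (auto simp: p1_def p2_def intro: finite_subset)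
      have intv: "\<exists>s t. K = {s..t} \<and> a \<le> s \<and> s \<le> t \<and> t \<le> b \<and> Inf K = s \<and> Sup K = t"
        if xK: "(x, K) \<in> p" for x K
      proof -
        have "x \<in> K" "K \<subseteq> {a..b}"
          using tagged_division_ofD(2,3)[OF ptag xK] by auto
        moreover obtain s t where "K = {s..t}"
          using tagged_division_ofD(4)[OF ptag xK] by auto
        ultimately show ?thesis by auto
      qed
      have int: "interior K = {Inf K<..<Sup K}" if xK: "(x, K) \<in> p" for x K
      proof -
        obtain s t where "K = {s..t}" "Inf K = s" "Sup K = t" using intv[OF xK] by auto
        then show ?thesis by (metis interior_atLeastAtMost_real)
      qed
      let ?r = "\<lambda>(x, K). measure lborel K *\<^sub>R h x - (f (Sup K) - f (Inf K))"
      have ba: "b - a = (\<Sum>(x,K)\<in>p. Sup K - Inf K)" "f b - f a = (\<Sum>(x,K)\<in>p. f (Sup K) - f (Inf K))"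
        using additive_tagged_division_1[where f= "\<lambda>x. x"] additive_tagged_division_1[where f= f]
              \<open>a \<le> b\<close> ptag by auto
      \<comment> \<open>Straddle estimate: the tag lies between the endpoints, so the linearization
        errors to its left and right add up to at most \<open>e1\<close> times the length of the
        interval.\<close>
      have "norm (sum ?r p2) \<le> (\<Sum>(x,K)\<in>p2. e1 * (Sup K - Inf K))"
      proof (rule sum_norm_le, safe)
        fix x K assume "(x, K) \<in> p2"
        then have xK: "(x, K) \<in> p" "x \<notin> E" by (auto simp: p2_def)
        obtain s t where K: "K = {s..t}" "a \<le> s" "s \<le> t" "t \<le> b" "Inf K = s" "Sup K = t"
          using intv[OF xK(1)] by auto
        have x: "x \<in> {s..t}" using tagged_division_ofD(2)[OF ptag xK(1)] K by simp
        have "K \<subseteq> ball x (d x)"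
          using fineD[OF fine xK(1)] xK(2) by (simp add: \<gamma>_def)
        then have st: "s \<in> ball x (d x)" "t \<in> ball x (d x)" using K by auto
        have "norm ((t - s) *\<^sub>R h x - (f t - f s))
            = norm ((f s - f x - (s - x) *\<^sub>R h x) - (f t - f x - (t - x) *\<^sub>R h x))"
          by (auto simp: algebra_simps)
        also have "\<dots> \<le> norm (f s - f x - (s - x) *\<^sub>R h x) + norm (f t - f x - (t - x) *\<^sub>R h x)"
          by (rule norm_triangle_ineq4)
        also have "\<dots> \<le> e1 * norm (s - x) + e1 * norm (t - x)"
          using K x xK st by (intro add_mono d(2)) (auto simp: dist_real_def)
        also have "\<dots> = e1 * (t - s)" using x by (auto simp: algebra_simps)
        finally show "norm (measure lborel K *\<^sub>R h x - (f (Sup K) - f (Inf K))) \<le> e1 * (Sup K - Inf K)"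
          using K by simp
      qed
      also have "\<dots> \<le> (\<Sum>(x,K)\<in>p. e1 * (Sup K - Inf K))"
        using fin(1) intv e1(1) by (intro sum_mono2) (fastforce simp: p2_def)+
      also have "\<dots> = e1 * (b - a)"
        unfolding ba(1) by (simp add: sum_distrib_left split_def)
      finally have sum2: "norm (sum ?r p2) < e / 2" using e1(2) by simp
      \<comment> \<open>Absolute continuity speaks of sets of endpoint pairs, so the tags must be
        forgotten without merging two members of \<open>p\<close>.\<close>
      define \<iota> where "\<iota> = (\<lambda>(x :: real, K :: real set). (Inf K, Sup K))"
      have ne: "x = y \<and> K = L"
        if "(x, K) \<in> p" "(y, L) \<in> p" "{Inf K<..<Sup K} \<inter> {Inf L<..<Sup L} \<noteq> {}" for x y K L
      proof (rule ccontr)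
        assume "\<not> ?thesis"
        then have "interior K \<inter> interior L = {}"
          using tagged_division_ofD(5)[OF ptag that(1,2)] by auto
        moreover have "interior K = {Inf K<..<Sup K}" "interior L = {Inf L<..<Sup L}"
          using int that by blast+
        ultimately show False using that(3) by simp
      qed
      have "x = y \<and> K = L"
        if xK: "(x, K) \<in> p" and yL: "(y, L) \<in> p" and eq: "\<iota> (x, K) = \<iota> (y, L)" for x K y L
      proof -
        obtain s t where K: "K = {s..t}" "s \<le> t" "Inf K = s" "Sup K = t"
          using intv[OF xK] by auto
        have L: "L = {s..t}" using intv[OF yL] eq K by (auto simp: \<iota>_def)
        show ?thesis
        \<comment> \<open>A one-point interval forces both tags to be that point. Otherwise the
          midpoint lies in both interiors, and distinct members of \<open>p\<close> have disjoint
          interiors.\<close>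
        proof (cases "s = t")
          case True
          then show ?thesis
            using tagged_division_ofD(2)[OF ptag xK] tagged_division_ofD(2)[OF ptag yL] K L by auto
        next
          case False
          then have "(s + t) / 2 \<in> {s<..<t}" using K by auto
          then show ?thesis using ne[OF xK yL] K L by auto
        qed
      qed
      then have inj: "inj_on \<iota> p"
        by (intro inj_onI) (metis surj_pair)
      then have inj1: "inj_on \<iota> p1" by (rule inj_on_subset) (auto simp: p1_def)
      have disj: "disjoint_family_on (\<lambda>(s, t). {s<..<t}) (\<iota> ` p1)"
        using ne by (fastforce simp: disjoint_family_on_def \<iota>_def p1_def)
      have bnds: "\<forall>(s, t)\<in>\<iota> ` p1. a \<le> s \<and> s \<le> t \<and> t \<le> b"
        using intv by (fastforce simp: \<iota>_def p1_def)
      \<comment> \<open>The total length is the measure of a disjoint union of intervals that the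
        gauge confines to \<open>T\<close>, hence less than \<open>\<delta>\<close>.\<close>
      have "(\<Sum>(s, t)\<in>\<iota> ` p1. t - s) = (\<Sum>c\<in>\<iota> ` p1. measure lebesgue ((\<lambda>(s, t). {s<..<t}) c))"
        using bnds by (intro sum.cong) auto
      also have "\<dots> = measure lebesgue (\<Union>c\<in>\<iota> ` p1. (\<lambda>(s, t). {s<..<t}) c)"
        using fin(2) disj bnds by (intro measure_finite_Union[symmetric]) auto
      also have "\<dots> \<le> measure lebesgue T"
      proof (rule measure_mono_fmeasurable[OF _ _ T(3)])
        show "(\<Union>c\<in>\<iota> ` p1. (\<lambda>(s, t). {s<..<t}) c) \<subseteq> T"
        proof
          fix r assume "r \<in> (\<Union>c\<in>\<iota> ` p1. (\<lambda>(s, t). {s<..<t}) c)"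
          then obtain x K where xK: "(x, K) \<in> p1" and r: "r \<in> {Inf K<..<Sup K}"
            by (auto simp: \<iota>_def)
          have "(x, K) \<in> p" "x \<in> E" using xK by (auto simp: p1_def)
          moreover from this have "K \<subseteq> T" using fineD[OF fine, of x K] by (simp add: \<gamma>_def)
          ultimately show "r \<in> T" using intv[of x K] r by auto
        qed
        show "(\<Union>c\<in>\<iota> ` p1. (\<lambda>(s, t). {s<..<t}) c) \<in> sets lebesgue"
          using fin(2) by (intro sets.finite_UN) auto
      qed
      finally have "(\<Sum>(s, t)\<in>\<iota> ` p1. t - s) < \<delta>" using T(4) by simp
      then have "(\<Sum>(s, t)\<in>\<iota> ` p1. norm (f t - f s)) < e / 2"
        using fin(2) bnds disj by (intro \<delta>) auto
      then have "(\<Sum>(x, K)\<in>p1. norm (f (Sup K) - f (Inf K))) < e / 2"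
        unfolding sum.reindex[OF inj1] by (simp add: \<iota>_def split_def comp_def)
      moreover have "norm (sum ?r p1) \<le> (\<Sum>(x, K)\<in>p1. norm (f (Sup K) - f (Inf K)))"
        by (rule sum_norm_le) (auto simp: p1_def h_def norm_minus_commute)
      ultimately have "norm (sum ?r p1) < e / 2" by linarith
      moreover have split: "(\<Sum>(x, K)\<in>p. measure lborel K *\<^sub>R h x) - (f b - f a) = sum ?r p1 + sum ?r p2"
        unfolding ba(2) sum_subtractf[symmetric]
        using fin p by (simp add: sum.union_disjoint split_def)
      ultimately show ?thesis
        unfolding split using sum2 norm_triangle_ineq[of "sum ?r p1" "sum ?r p2"] by linarith
    qed
    ultimately show "\<exists>\<gamma>. gauge \<gamma> \<and> (\<forall>\<D>. \<D> tagged_division_of {a..b} \<and> \<gamma> fine \<D> \<longrightarrow>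
        norm ((\<Sum>(x, K)\<in>\<D>. measure lborel K *\<^sub>R h x) - (f b - f a)) < e)"
      by (intro exI[of _ \<gamma>] conjI allI impI) (assumption | elim conjE)+
  qed
  then show ?thesis
    by (rule has_integral_spike[OF E, rotated]) (simp add: h_def)
qed

lemma AE_lebesgue_obtain_negligible:
  fixes P :: "'a::euclidean_space \<Rightarrow> bool"
  assumes "AE x in lebesgue. P x"
  obtains E where "negligible E" "\<And>x. x \<notin> E \<Longrightarrow> P x"
  using assms unfolding eventually_ae_filter negligible_iff_null_sets by auto

text \<open>Integrate \<open>L \<circ> f'\<close>, which agrees with \<open>c\<close> off a null
  set. This turns almost-everywhere information on the velocity into explicit coordinates of the
  curve, and shows that components with zero derivative are constant.\<close>

lemma abs_continuous_linear_image:
  fixes f :: "real \<Rightarrow> 'a::banach" and L :: "'a \<Rightarrow> 'b::banach"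
  assumes ac: "abs_continuous f" and L: "bounded_linear L"
    and der: "AE t in lebesgue. (f has_vector_derivative f' t) (at t)"
    and const: "AE t in lebesgue. L (f' t) = c"
  shows "L (f t) = L (f 0) + t *\<^sub>R c"
proof -
  have *: "L (f b) - L (f a) = (b - a) *\<^sub>R c" if "a \<le> b" for a b
  proof -
    have "AE t in lebesgue. (f has_vector_derivative f' t) (at t) \<and> L (f' t) = c"
      using der const by auto
    then obtain E where E: "negligible E"
      "\<And>t. t \<notin> E \<Longrightarrow> (f has_vector_derivative f' t) (at t) \<and> L (f' t) = c"
      by (rule AE_lebesgue_obtain_negligible) blast
    have "(f' has_integral (f b - f a)) {a..b}"
      using ac E that
      by (intro abs_continuous_on_has_integral[where E = E])
         (auto simp: abs_continuous_def has_vector_derivative_at_within)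
    from has_integral_linear[OF this L] have "((L \<circ> f') has_integral L (f b - f a)) {a..b}" .
    then have "((\<lambda>_. c) has_integral L (f b - f a)) {a..b}"
      by (rule has_integral_spike[OF E(1), rotated]) (simp add: E(2))
    moreover have "((\<lambda>_. c) has_integral (b - a) *\<^sub>R c) {a..b}"
      using has_integral_const_real[of c a b] that by simp
    ultimately show ?thesis
      using L by (metis has_integral_unique bounded_linear.linear linear_diff)
  qed
  show ?thesis
  proof (cases "0 \<le> t")
    case True
    then show ?thesis using *[of 0 t] by (simp add: algebra_simps)
  next
    case False
    then show ?thesis using *[of t 0] by (simp add: algebra_simps)
  qed
qed

text \<open>Absolute continuity on \<open>[t - 1, t + 1]\<close> is applied to families consisting
  of a single interval with endpoint \<open>t\<close>.\<close>

lemma abs_continuous_imp_continuous_on: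
  assumes "abs_continuous f"
  shows "continuous_on UNIV f"
  unfolding continuous_on_iff
proof (intro ballI allI impI)
  fix t :: real and e :: real assume "e > 0"
  obtain \<delta> where "\<delta> > 0" and \<delta>: "\<And>P :: (real \<times> real) set.
        finite P \<Longrightarrow> (\<forall>(r, s)\<in>P. t - 1 \<le> r \<and> r \<le> s \<and> s \<le> t + 1) \<Longrightarrow>
        disjoint_family_on (\<lambda>(r, s). {r<..<s}) P \<Longrightarrow> (\<Sum>(r, s)\<in>P. s - r) < \<delta> \<Longrightarrow>
        (\<Sum>(r, s)\<in>P. norm (f s - f r)) < e"
    using assms[unfolded abs_continuous_def abs_continuous_on_def, rule_format, of e "t - 1" "t + 1"]
      \<open>e > 0\<close> by auto
  have *: "norm (f s - f r) < e" if "t - 1 \<le> r" "r \<le> s" "s \<le> t + 1" "s - r < \<delta>" for r s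
    using \<delta>[of "{(r, s)}"] that by (simp add: disjoint_family_on_def)
  have "dist (f s) (f t) < e" if "dist s t < min \<delta> 1" for s
  proof (cases "s \<le> t")
    case True
    then show ?thesis
      using *[of s t] that by (auto simp: dist_norm norm_minus_commute)
  next
    case False
    then show ?thesis
      using *[of t s] that by (auto simp: dist_norm)
  qed
  with \<open>\<delta> > 0\<close> show "\<exists>d>0. \<forall>s\<in>UNIV. dist s t < d \<longrightarrow> dist (f s) (f t) < e"
    by (intro exI[of _ "min \<delta> 1"]) auto
qed

text \<open>The fibre over \<open>c\<close> is closed and of full measure, hence everything.
  Identities found at almost all times thus hold at all times.\<close>

lemma AE_continuous_on_eq:
  fixes f :: "'a::euclidean_space \<Rightarrow> 'b::t1_space"
  assumes "continuous_on UNIV f" "AE t in lebesgue. f t = c"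
  shows "f t = c"
proof -
  have "closed (f -` {c})"
    using assms(1) by (intro closed_vimage) auto
  from mem_closed_if_AE_lebesgue[OF this, of t] assms(2) show ?thesis by simp
qed

section \<open>Local injectivity and the sign of the derivative\<close>

text \<open>Around a point \<open>s\<close> of the interval of radius \<open>e\<close> about
  \<open>t\<close>, the smaller radius \<open>e - dist s t\<close> stays inside it. This yields
  openness of the sets of points of local increase and of local decrease.\<close>

lemma open_interval_property:
  fixes P :: "real set \<Rightarrow> bool"
  assumes "\<And>S T. P T \<Longrightarrow> S \<subseteq> T \<Longrightarrow> P S"
  shows "open {t. \<exists>e>0. P {t - e<..<t + e}}"
  unfolding open_dist
proof safe
  fix t e :: real assume e: "e > 0" "P {t - e<..<t + e}"
  have "P {s - (e - dist s t)<..<s + (e - dist s t)}" for s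
    by (rule assms[OF e(2)]) (auto simp: dist_real_def)
  with e(1) show "\<exists>d>0. \<forall>s. dist s t < d \<longrightarrow> s \<in> {t. \<exists>e>0. P {t - e<..<t + e}}"
    by (intro exI[of _ e]) (auto intro!: exI[of _ "e - dist _ t"])
qed

text \<open>The points near which the function increases and those near which it decreases form
  two disjoint open sets covering the connected line.\<close>

lemma locally_inj_derivative_sign:
  fixes f :: "real \<Rightarrow> real"
  assumes cont: "continuous_on UNIV f" and inj: "\<And>t. \<exists>e>0. inj_on f {t - e<..<t + e}"
  shows "(\<forall>t D. (f has_real_derivative D) (at t) \<longrightarrow> D \<ge> 0) \<or>
         (\<forall>t D. (f has_real_derivative D) (at t) \<longrightarrow> D \<le> 0)"
proof -
  define A where "A = {t. \<exists>e>0. strict_mono_on {t - e<..<t + e} f}"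
  define B where "B = {t. \<exists>e>0. strict_antimono_on {t - e<..<t + e} f}"
  have "open A" unfolding A_def
    by (rule open_interval_property) (auto intro: monotone_on_subset)
  moreover have "open B" unfolding B_def
    by (rule open_interval_property) (auto intro: monotone_on_subset)
  moreover have "A \<inter> B = {}"
  proof safe
    fix t assume "t \<in> A" "t \<in> B"
    then obtain a b where ab: "a > 0" "b > 0"
      "strict_mono_on {t - a<..<t + a} f" "strict_antimono_on {t - b<..<t + b} f"
      by (auto simp: A_def B_def)
    \<comment> \<open>Half of the smaller radius puts \<open>s\<close> to the right of
      \<open>t\<close> and inside both neighbourhoods, where the two monotonicities contradict each
      other.\<close>
    define s where "s = t + min a b / 2"
    have "t < s" "s \<in> {t - a<..<t + a}" "s \<in> {t - b<..<t + b}"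
      using ab(1,2) by (auto simp: s_def min_def field_simps)
    then have "f t < f s" "f s < f t"
      using monotone_onD[OF ab(3), of t s] monotone_onD[OF ab(4), of t s] ab(1,2) by auto
    then show "t \<in> {}" by simp
  qed
  moreover have "A \<union> B = UNIV"
  proof -
    have "t \<in> A \<union> B" for t
    proof -
      obtain e where e: "e > 0" "inj_on f {t - e<..<t + e}" using inj by blast
      \<comment> \<open>A continuous injective function on an interval is strictly monotone
        there.\<close>
      have "strict_mono_on {t - e<..<t + e} f \<or> strict_antimono_on {t - e<..<t + e} f"
        using e(2) injective_eq_monotone_map[of "{t - e<..<t + e}" f]
          continuous_on_subset[OF cont] by (auto simp: is_interval_convex_1)
      then show ?thesis using e(1) by (auto simp: A_def B_def)
    qed
    then show ?thesis by blast
  qed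
  ultimately have "A = UNIV \<or> B = UNIV"
    using connectedD[of "UNIV :: real set" A B] connected_UNIV by auto
  then show ?thesis
  proof
    assume A: "A = UNIV"
    have "D \<ge> 0" if D: "(f has_real_derivative D) (at t)" for t D
    proof -
      obtain e where e: "e > 0" "strict_mono_on {t - e<..<t + e} f"
        using A by (auto simp: A_def)
      show ?thesis
        by (rule mono_on_imp_deriv_nonneg[OF strict_mono_on_imp_mono_on[OF e(2)] D])
           (use e(1) in \<open>auto simp: interior_open\<close>)
    qed
    then show ?thesis by blast
  next
    assume B: "B = UNIV"
    have "D \<le> 0" if D: "(f has_real_derivative D) (at t)" for t D
    proof -
      obtain e where e: "e > 0" "strict_antimono_on {t - e<..<t + e} f"
        using B by (auto simp: B_def)
      have "mono_on {t - e<..<t + e} (\<lambda>t. - f t)"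
        using e(2) by (fastforce simp: monotone_on_def order_le_less)
      from mono_on_imp_deriv_nonneg[OF this DERIV_minus[OF D]] e(1)
      show ?thesis by (auto simp: interior_open)
    qed
    then show ?thesis by blast
  qed
qed

section \<open>Quasinorms and supporting functionals\<close>

lemma quasinorm_scaleR: "quasinorm F \<Longrightarrow> c \<ge> 0 \<Longrightarrow> F (c *\<^sub>R u) = c * F u"
  unfolding quasinorm_def by blast

lemma quasinorm_pos: "quasinorm F \<Longrightarrow> u \<noteq> 0 \<Longrightarrow> F u > 0"
  unfolding quasinorm_def by (metis less_le)

lemma quasinorm_normalize: "quasinorm F \<Longrightarrow> u \<noteq> 0 \<Longrightarrow> F ((1 / F u) *\<^sub>R u) = 1"
  using quasinorm_pos[of F u] by (simp add: quasinorm_scaleR)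

text \<open>The test vector is \<open>p\<close> itself, scaled into the unit body: a negative or
  zero value there gives \<open>p \<bullet> p \<le> 0\<close>.\<close>

lemma unit_body_annihilator:
  assumes "quasinorm F" "\<And>u. u \<in> unit_body F \<Longrightarrow> p \<bullet> u \<le> 0"
  shows "p = 0"
proof (rule ccontr)
  assume "p \<noteq> 0"
  then have "F ((1 / F p) *\<^sub>R p) = 1" "F p > 0"
    using assms(1) by (auto intro: quasinorm_normalize quasinorm_pos)
  with assms(2)[of "(1 / F p) *\<^sub>R p"] have "p \<bullet> p \<le> 0"
    by (simp add: unit_body_def field_simps)
  with \<open>p \<noteq> 0\<close> show False by (metis inner_gt_zero_iff not_le)
qed

text \<open>A hyperplane separates \<open>u\<close> from the open unit ball, and its bound passes to
  the closed one. Its normal later serves as the covector with \<open>M > 0\<close>.\<close>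

lemma unit_body_supporting_functional:
  assumes F: "quasinorm F" and u: "F u = 1"
  obtains p where "p \<bullet> u > 0" "\<And>u'. u' \<in> unit_body F \<Longrightarrow> p \<bullet> u' \<le> p \<bullet> u"
proof -
  have "convex {u. F u < 1}"
  proof (rule convexI, safe)
    fix x y and a b :: real
    assume *: "F x < 1" "F y < 1" "0 \<le> a" "0 \<le> b" "a + b = 1"
    have "F (a *\<^sub>R x + b *\<^sub>R y) \<le> F (a *\<^sub>R x) + F (b *\<^sub>R y)"
      using F unfolding quasinorm_def by blast
    also have "\<dots> = a * F x + b * F y"
      using F * by (simp add: quasinorm_scaleR)
    also have "\<dots> < 1"
      using * by (rule convex_bound_lt)
    finally show "F (a *\<^sub>R x + b *\<^sub>R y) < 1" .
  qed
  moreover have "F 0 = 0" using F unfolding quasinorm_def by blast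
  then have "0 \<in> {u. F u < 1}" by simp
  ultimately have "\<exists>p c. p \<noteq> 0 \<and> (\<forall>x\<in>{u. F u < 1}. p \<bullet> x \<le> c) \<and> (\<forall>x\<in>{u}. c \<le> p \<bullet> x)"
    using u by (intro separating_hyperplane_sets) (blast | auto)+
  then obtain p c where p: "p \<noteq> 0" "\<And>x. F x < 1 \<Longrightarrow> p \<bullet> x \<le> c" "c \<le> p \<bullet> u"
    by blast
  \<comment> \<open>A boundary point \<open>x\<close> of the body is approached from the open ball
    by \<open>r x\<close> with \<open>0 < r < 1\<close>.\<close>
  have le: "p \<bullet> x \<le> c" if "x \<in> unit_body F" for x
  proof (rule field_le_mult_one_interval)
    fix r :: real assume r: "0 < r" "r < 1"
    have "F x \<le> 1" using that by (simp add: unit_body_def)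
    then have "r * F x \<le> r" using r by (intro mult_left_le) auto
    with r have "F (r *\<^sub>R x) < 1" unfolding quasinorm_scaleR[OF F less_imp_le[OF r(1)]] by linarith
    from p(2)[OF this] show "r * (p \<bullet> x) \<le> c" by simp
  qed
  show ?thesis
  proof (rule that)
    show "p \<bullet> x \<le> p \<bullet> u" if "x \<in> unit_body F" for x
      using le[OF that] p(3) by simp
    \<comment> \<open>If \<open>c\<close> were at most 0, then \<open>p\<close> would be nonpositive
      on the whole unit body and hence zero.\<close>
    have "\<not> c \<le> 0"
      using unit_body_annihilator[OF F, of p] le p(1) by force
    then show "p \<bullet> u > 0" using p(3) by simp
  qed
qed

section \<open>The Hamiltonian system and the derivatives of the momenta\<close>

text \<open>\<open>Z = [X, Y]\<close> in coordinates.\<close>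

fun field_Z :: "R5 \<Rightarrow> R5" where
  "field_Z (x, y, z, v, w) = (0, 0, 1, x / 2, y / 2)"

text \<open>These are the partial derivatives of the Hamiltonian in x, y, z, v, w; the last two
  vanish since the fields do not depend on v and w.\<close>

fun hamiltonian_gradient :: "R5 \<Rightarrow> R5 \<Rightarrow> R2 \<Rightarrow> R5" where
  "hamiltonian_gradient (p1, p2, p3, p4, p5) (x, y, z, v, w) (a, b) =
     (b * (p3 / 2 + p4 * x / 6 + p5 * y / 12) - a * p4 * y / 12,
      b * p5 * x / 12 - a * (p3 / 2 + p4 * x / 12 + p5 * y / 6),
      - (a * p4 + b * p5) / 2, 0, 0)"

lemma hamiltonian_eq_inner: "hamiltonian p q u = (p \<bullet> field_X q, p \<bullet> field_Y q) \<bullet> u"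
  by (cases u) (simp add: hamiltonian_def)

lemma field_X_eq: "field_X q = (1, 0, - fst (snd q) / 2,
    - (fst (snd (snd q)) + fst q * fst (snd q) / 6) / 2, - (fst (snd q))\<^sup>2 / 12)"
  by (cases q) simp

lemma field_Y_eq: "field_Y q = (0, 1, fst q / 2, (fst q)\<^sup>2 / 12,
    - (fst (snd (snd q)) - fst q * fst (snd q) / 6) / 2)"
  by (cases q) simp

lemma field_Z_eq: "field_Z q = (0, 0, 1, fst q / 2, fst (snd q) / 2)"
  by (cases q) simp

lemma GDERIV_hamiltonian:
  "GDERIV (\<lambda>q. hamiltonian p q u) q :> hamiltonian_gradient p q u"
proof -
  obtain p1 p2 p3 p4 p5 where p: "p = (p1, p2, p3, p4, p5)" by (metis prod.exhaust)
  obtain x y z v w where q: "q = (x, y, z, v, w)" by (metis prod.exhaust)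
  obtain a b where u: "u = (a, b)" by fastforce
  have "((\<lambda>q. (p1 - p3 * fst (snd q) / 2 - p4 * fst q * fst (snd q) / 12 - p5 * (fst (snd q))\<^sup>2 / 12
        - p4 * fst (snd (snd q)) / 2) * a
      + (p2 + p3 * fst q / 2 + p4 * (fst q)\<^sup>2 / 12 + p5 * fst q * fst (snd q) / 12
        - p5 * fst (snd (snd q)) / 2) * b) has_derivative
      (\<lambda>h. h \<bullet> hamiltonian_gradient p q u)) (at q)"
    by (rule derivative_eq_intros refl ext | simp)+
      (auto simp: p q u inner_prod_def field_simps power2_eq_square)
  moreover have "hamiltonian p q u = (p1 - p3 * fst (snd q) / 2 - p4 * fst q * fst (snd q) / 12
        - p5 * (fst (snd q))\<^sup>2 / 12 - p4 * fst (snd (snd q)) / 2) * a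
      + (p2 + p3 * fst q / 2 + p4 * (fst q)\<^sup>2 / 12 + p5 * fst q * fst (snd q) / 12
        - p5 * fst (snd (snd q)) / 2) * b" for q
    by (cases q) (simp only: p u hamiltonian_def inner_field_X inner_field_Y fst_conv snd_conv)
  ultimately show ?thesis by (simp add: gderiv_def)
qed

text \<open>\<open>pontryagin\<close> only asserts that some gradient \<open>D\<close> exists;
  uniqueness of derivatives identifies it with the explicit formula.\<close>

lemma GDERIV_hamiltonian_unique:
  assumes "GDERIV (\<lambda>q. hamiltonian p q u) q :> D"
  shows "D = hamiltonian_gradient p q u"
proof -
  have "(\<lambda>h. h \<bullet> D) = (\<lambda>h. h \<bullet> hamiltonian_gradient p q u)"
    using assms GDERIV_hamiltonian[of p u q] unfolding gderiv_def by (rule has_derivative_unique)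
  then have "\<forall>h. h \<bullet> D = h \<bullet> hamiltonian_gradient p q u" by (auto dest: fun_cong)
  then show ?thesis by (simp only: vector_eq_ldot)
qed

lemma continuous_on_inner_fields:
  assumes "continuous_on UNIV \<psi>" "continuous_on UNIV g"
  shows "continuous_on UNIV (\<lambda>t. \<psi> t \<bullet> field_X (g t))"
    and "continuous_on UNIV (\<lambda>t. \<psi> t \<bullet> field_Y (g t))"
    and "continuous_on UNIV (\<lambda>t. \<psi> t \<bullet> field_Z (g t))"
  unfolding field_X_eq field_Y_eq field_Z_eq
  by (auto intro!: continuous_intros assms)

lemma has_vector_derivative_components:
  fixes f :: "real \<Rightarrow> R5"
  assumes "(f has_vector_derivative (a, b, c, d, e)) (at t)"
  shows "((\<lambda>t. fst (f t)) has_real_derivative a) (at t)"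
    and "((\<lambda>t. fst (snd (f t))) has_real_derivative b) (at t)"
    and "((\<lambda>t. fst (snd (snd (f t)))) has_real_derivative c) (at t)"
    and "((\<lambda>t. fst (snd (snd (snd (f t))))) has_real_derivative d) (at t)"
    and "((\<lambda>t. snd (snd (snd (snd (f t))))) has_real_derivative e) (at t)"
  unfolding has_real_derivative_iff_has_vector_derivative
  using bounded_linear.has_vector_derivative[OF bounded_linear_fst assms]
    bounded_linear.has_vector_derivative[OF
      bounded_linear_fst_comp[OF bounded_linear_snd] assms]
    bounded_linear.has_vector_derivative[OF
      bounded_linear_fst_comp[OF bounded_linear_snd_comp[OF bounded_linear_snd]] assms]
    bounded_linear.has_vector_derivative[OF
      bounded_linear_fst_comp[OF bounded_linear_snd_comp[OF bounded_linear_snd_comp[OF bounded_linear_snd]]] assms]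
    bounded_linear.has_vector_derivative[OF
      bounded_linear_snd_comp[OF bounded_linear_snd_comp[OF bounded_linear_snd_comp[OF bounded_linear_snd]]] assms]
  unfolding fst_conv snd_conv by blast+

text \<open>For the momenta h1, h2, h3 of X, Y, Z these are h1' = -u2 h3, h2' = u1 h3 and h3' = psi4
  u1 + psi5 u2. They mirror [X,Y] = Z, [X,Z] = V, [Y,Z] = W; the momenta of the central V and W are
  psi4 and psi5.\<close>

lemma momentum_derivatives:
  fixes g \<psi> :: "real \<Rightarrow> R5"
  assumes g: "(g has_vector_derivative
      fst (u t) *\<^sub>R field_X (g t) + snd (u t) *\<^sub>R field_Y (g t)) (at t)"
    and \<psi>: "(\<psi> has_vector_derivative - hamiltonian_gradient (\<psi> t) (g t) (u t)) (at t)"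
  shows "((\<lambda>t. \<psi> t \<bullet> field_X (g t)) has_real_derivative - snd (u t) * (\<psi> t \<bullet> field_Z (g t))) (at t)"
    and "((\<lambda>t. \<psi> t \<bullet> field_Y (g t)) has_real_derivative fst (u t) * (\<psi> t \<bullet> field_Z (g t))) (at t)"
    and "((\<lambda>t. \<psi> t \<bullet> field_Z (g t)) has_real_derivative
           (fst (snd (snd (snd (\<psi> t)))), snd (snd (snd (snd (\<psi> t))))) \<bullet> u t) (at t)"
proof -
  define p1 where "p1 s = fst (\<psi> s)" for s
  define p2 where "p2 s = fst (snd (\<psi> s))" for s
  define p3 where "p3 s = fst (snd (snd (\<psi> s)))" for s
  define p4 where "p4 s = fst (snd (snd (snd (\<psi> s))))" for s
  define p5 where "p5 s = snd (snd (snd (snd (\<psi> s))))" for s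
  note p_def = p1_def p2_def p3_def p4_def p5_def
  define x where "x s = fst (g s)" for s
  define y where "y s = fst (snd (g s))" for s
  define z where "z s = fst (snd (snd (g s)))" for s
  define v where "v s = fst (snd (snd (snd (g s))))" for s
  define w where "w s = snd (snd (snd (snd (g s))))" for s
  note q_def = x_def y_def z_def v_def w_def
  obtain a b where u: "u t = (a, b)" by fastforce
  have p: "\<psi> s = (p1 s, p2 s, p3 s, p4 s, p5 s)" for s by (simp add: p_def)
  have q: "g s = (x s, y s, z s, v s, w s)" for s by (simp add: q_def)
  note dg = has_vector_derivative_components[OF g[unfolded q[of t] u,
      unfolded field_X.simps field_Y.simps fst_conv snd_conv scaleR_Pair add_Pair], folded q_def]
  note d\<psi> = has_vector_derivative_components[OF \<psi>[unfolded p[of t] q[of t] u,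
      unfolded hamiltonian_gradient.simps uminus_Pair], folded p_def]
  have "((\<lambda>t. p1 t - p3 t * y t / 2 - p4 t * x t * y t / 12 - p5 t * (y t)\<^sup>2 / 12 - p4 t * z t / 2)
      has_real_derivative - b * (p3 t + p4 t * x t / 2 + p5 t * y t / 2)) (at t)"
    by (auto intro!: derivative_eq_intros dg d\<psi> simp: field_simps power2_eq_square)
  then show "((\<lambda>t. \<psi> t \<bullet> field_X (g t)) has_real_derivative
      - snd (u t) * (\<psi> t \<bullet> field_Z (g t))) (at t)"
    unfolding u p q inner_field_X by (simp add: field_simps)
  have "((\<lambda>t. p2 t + p3 t * x t / 2 + p4 t * (x t)\<^sup>2 / 12 + p5 t * x t * y t / 12 - p5 t * z t / 2)
      has_real_derivative a * (p3 t + p4 t * x t / 2 + p5 t * y t / 2)) (at t)"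
    by (auto intro!: derivative_eq_intros dg d\<psi> simp: field_simps power2_eq_square)
  then show "((\<lambda>t. \<psi> t \<bullet> field_Y (g t)) has_real_derivative
      fst (u t) * (\<psi> t \<bullet> field_Z (g t))) (at t)"
    unfolding u p q inner_field_Y by (simp add: field_simps)
  have "((\<lambda>t. p3 t + p4 t * x t / 2 + p5 t * y t / 2)
      has_real_derivative p4 t * a + p5 t * b) (at t)"
    by (auto intro!: derivative_eq_intros dg d\<psi> simp: field_simps)
  then show "((\<lambda>t. \<psi> t \<bullet> field_Z (g t)) has_real_derivative
      (fst (snd (snd (snd (\<psi> t)))), snd (snd (snd (snd (\<psi> t))))) \<bullet> u t) (at t)"
    unfolding u p q by (simp add: field_simps)
qed

section \<open>Consequences of a vanishing maximum\<close>

lemma abnormal_AE_derivatives: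
  assumes "abnormal_extremal F g u \<psi>"
  shows "AE t in lebesgue. (g has_vector_derivative
      fst (u t) *\<^sub>R field_X (g t) + snd (u t) *\<^sub>R field_Y (g t)) (at t)"
    and "AE t in lebesgue. (\<psi> has_vector_derivative - hamiltonian_gradient (\<psi> t) (g t) (u t)) (at t)"
proof -
  show "AE t in lebesgue. (g has_vector_derivative
      fst (u t) *\<^sub>R field_X (g t) + snd (u t) *\<^sub>R field_Y (g t)) (at t)"
    using assms by (simp add: abnormal_extremal_def pontryagin_def trajectory_def)
  have "AE t in lebesgue. \<exists>D. GDERIV (\<lambda>q. hamiltonian (\<psi> t) q (u t)) (g t) :> D \<and>
      (\<psi> has_vector_derivative - D) (at t)"
    using assms by (simp add: abnormal_extremal_def pontryagin_def)
  then show "AE t in lebesgue.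
      (\<psi> has_vector_derivative - hamiltonian_gradient (\<psi> t) (g t) (u t)) (at t)"
    by eventually_elim (metis GDERIV_hamiltonian_unique)
qed

lemma abnormal_continuous_on:
  assumes "abnormal_extremal F g u \<psi>"
  shows "continuous_on UNIV \<psi>" "continuous_on UNIV g"
  using assms
  by (auto intro!: abs_continuous_imp_continuous_on
      simp: abnormal_extremal_def pontryagin_def trajectory_def)

text \<open>At almost every time the pair of momenta is a functional that is nonpositive on the unit
  body, hence zero; continuity covers the remaining times.\<close>

lemma abnormal_annihilates_X_Y:
  assumes F: "quasinorm F" and ab: "abnormal_extremal F g u \<psi>"
  shows "\<psi> t \<bullet> field_X (g t) = 0" "\<psi> t \<bullet> field_Y (g t) = 0"
proof -
  have "AE t in lebesgue. \<forall>u'\<in>unit_body F. hamiltonian (\<psi> t) (g t) u' \<le> 0"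
    using ab by (auto simp: abnormal_extremal_def pontryagin_def)
  then have ae: "AE t in lebesgue. (\<psi> t \<bullet> field_X (g t), \<psi> t \<bullet> field_Y (g t)) = 0"
  proof eventually_elim
    case (elim t)
    show ?case
      by (rule unit_body_annihilator[OF F]) (use elim in \<open>simp only: hamiltonian_eq_inner\<close>)
  qed
  note cont = continuous_on_inner_fields[OF abnormal_continuous_on[OF ab]]
  show "\<psi> t \<bullet> field_X (g t) = 0"
    by (rule AE_continuous_on_eq[OF cont(1)]) (use ae in eventually_elim, simp add: zero_prod_def)
  show "\<psi> t \<bullet> field_Y (g t) = 0"
    by (rule AE_continuous_on_eq[OF cont(2)]) (use ae in eventually_elim, simp add: zero_prod_def)
qed

lemma unit_speed_nonzero: "quasinorm F \<Longrightarrow> F u = 1 \<Longrightarrow> u \<noteq> 0"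
  unfolding quasinorm_def by (metis zero_neq_one)

lemma abnormal_annihilates_Z:
  assumes F: "quasinorm F" and ab: "abnormal_extremal F g u \<psi>" and unit: "arclength_parametrized F u"
  shows "\<psi> t \<bullet> field_Z (g t) = 0"
proof (rule AE_continuous_on_eq[where f = "\<lambda>t. \<psi> t \<bullet> field_Z (g t)"])
  show "continuous_on UNIV (\<lambda>t. \<psi> t \<bullet> field_Z (g t))"
    by (rule continuous_on_inner_fields[OF abnormal_continuous_on[OF ab]])
  show "AE t in lebesgue. \<psi> t \<bullet> field_Z (g t) = 0"
    using abnormal_AE_derivatives[OF ab] unit[unfolded arclength_parametrized_def]
  proof eventually_elim
    case (elim t)
    \<comment> \<open>Both momenta are identically zero, so their derivatives -u2 h3 and u1 h3
      vanish, and one of u1, u2 is nonzero.\<close>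
    note d = momentum_derivatives(1,2)[where g = g and \<psi> = \<psi> and u = u, OF elim(1,2), unfolded abnormal_annihilates_X_Y[OF F ab]]
    have "- snd (u t) * (\<psi> t \<bullet> field_Z (g t)) = 0" "fst (u t) * (\<psi> t \<bullet> field_Z (g t)) = 0"
      using DERIV_unique[OF d(1) DERIV_const] DERIV_unique[OF d(2) DERIV_const] .
    moreover have "u t \<noteq> 0" using unit_speed_nonzero[OF F elim(3)] .
    ultimately show ?case by (auto simp: prod_eq_iff)
  qed
qed

text \<open>The coordinates v and w are cyclic: the adjoint equation gives their covector components
  derivative zero.\<close>

lemma abnormal_covector_const:
  assumes ab: "abnormal_extremal F g u \<psi>"
  shows "fst (snd (snd (snd (\<psi> t)))) = fst (snd (snd (snd (\<psi> 0))))"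
    and "snd (snd (snd (snd (\<psi> t)))) = snd (snd (snd (snd (\<psi> 0))))"
proof -
  have ac: "abs_continuous \<psi>"
    using ab by (simp add: abnormal_extremal_def pontryagin_def)
  have grad: "fst (snd (snd (snd (- hamiltonian_gradient p q r)))) = 0"
    "snd (snd (snd (snd (- hamiltonian_gradient p q r)))) = 0" for p q r
    by (cases "(p, q, r)" rule: hamiltonian_gradient.cases; simp)+
  show "fst (snd (snd (snd (\<psi> t)))) = fst (snd (snd (snd (\<psi> 0))))"
    using abs_continuous_linear_image[OF ac _ abnormal_AE_derivatives(2)[OF ab],
        of "\<lambda>p. fst (snd (snd (snd p)))" 0 t] grad
    by (simp add: bounded_linear_fst_comp bounded_linear_snd_comp bounded_linear_snd)
  show "snd (snd (snd (snd (\<psi> t)))) = snd (snd (snd (snd (\<psi> 0))))"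
    using abs_continuous_linear_image[OF ac _ abnormal_AE_derivatives(2)[OF ab],
        of "\<lambda>p. snd (snd (snd (snd p)))" 0 t] grad
    by (simp add: bounded_linear_snd_comp bounded_linear_snd)
qed

text \<open>The momentum of Z is identically zero, so its derivative psi4 u1 + psi5 u2 vanishes too,
  and its coefficients keep their initial values.\<close>

lemma abnormal_control_orthogonal:
  assumes F: "quasinorm F" and ab: "abnormal_extremal F g u \<psi>" and unit: "arclength_parametrized F u"
    and \<psi>0: "\<psi> 0 = (\<phi>1, \<phi>2, \<phi>3, \<phi>4, \<phi>5)"
  shows "AE t in lebesgue. (\<phi>4, \<phi>5) \<bullet> u t = 0"
  using abnormal_AE_derivatives[OF ab]
proof eventually_elim
  case (elim t)
  note d = momentum_derivatives(3)[where g = g and \<psi> = \<psi> and u = u, OF elim, unfolded abnormal_annihilates_Z[OF F ab unit]]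
  show ?case
    using DERIV_unique[OF d DERIV_const] abnormal_covector_const[OF ab, of t] \<psi>0 by simp
qed

text \<open>At the unit X, Y, Z are the first three coordinate vectors, so the annihilation
  identities kill the first three components of the nonzero covector.\<close>

lemma abnormal_covector_nonzero:
  assumes F: "quasinorm F" and ab: "abnormal_extremal F g u \<psi>" and unit: "arclength_parametrized F u"
    and g0: "g 0 = 0" and \<psi>0: "\<psi> 0 = (\<phi>1, \<phi>2, \<phi>3, \<phi>4, \<phi>5)"
  shows "(\<phi>4, \<phi>5) \<noteq> 0"
proof -
  have "\<psi> 0 \<noteq> 0"
    using ab by (simp add: abnormal_extremal_def pontryagin_def)
  moreover have "\<phi>1 = 0" "\<phi>2 = 0" "\<phi>3 = 0"
    using abnormal_annihilates_X_Y[OF F ab, of 0] abnormal_annihilates_Z[OF F ab unit, of 0] g0 \<psi>0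
    by (simp_all add: zero_prod_def)
  ultimately show ?thesis using \<psi>0 by (simp add: zero_prod_def)
qed

section \<open>Trajectories whose horizontal projection stays on a line\<close>

text \<open>Both vectors lie on the line orthogonal to \<open>(p, q)\<close>, so their determinant
  vanishes.\<close>

lemma planar_parallel:
  fixes a b x y p q :: real
  assumes "(p, q) \<noteq> 0" "p * x + q * y = 0" "p * a + q * b = 0"
  shows "x * b = y * a"
proof (cases "p = 0")
  case True
  with assms show ?thesis by (simp add: zero_prod_def)
next
  case False
  have "p * (x * b - y * a) = (p * x + q * y) * b - (p * a + q * b) * y" by algebra
  with assms False show ?thesis by simp
qed

text \<open>Once the horizontal projection stays on a line, \<open>x u\<^sub>2 = y u\<^sub>1\<close> makes the remaining
  coordinates constant.\<close>

lemma trajectory_in_line: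
  assumes tr: "trajectory F g u" and g0: "g 0 = 0"
    and n: "(p, q) \<noteq> (0 :: R2)" and orth: "AE t in lebesgue. (p, q) \<bullet> u t = 0"
  shows "p * fst (g t) + q * fst (snd (g t)) = 0 \<and> snd (snd (g t)) = 0"
proof -
  have ac: "abs_continuous g" and der: "AE t in lebesgue. (g has_vector_derivative
      fst (u t) *\<^sub>R field_X (g t) + snd (u t) *\<^sub>R field_Y (g t)) (at t)"
    using tr by (simp_all add: trajectory_def)
  have "bounded_linear (\<lambda>r :: R5. p * fst r + q * fst (snd r))"
    by (intro bounded_linear_intros)
  moreover have "AE t in lebesgue.
      (\<lambda>r. p * fst r + q * fst (snd r)) (fst (u t) *\<^sub>R field_X (g t) + snd (u t) *\<^sub>R field_Y (g t)) = 0"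
    using orth by eventually_elim (simp add: field_X_eq field_Y_eq inner_prod_def)
  ultimately have line: "p * fst (g t) + q * fst (snd (g t)) = 0" for t
    using abs_continuous_linear_image[OF ac _ der, of "\<lambda>r. p * fst r + q * fst (snd r)" 0 t] g0
    by simp
  have par: "AE t in lebesgue. fst (g t) * snd (u t) = fst (snd (g t)) * fst (u t)"
    using orth by eventually_elim (rule planar_parallel[OF n line], simp add: inner_prod_def)
  have "bounded_linear (\<lambda>r :: R5. fst (snd (snd r)))"
    by (intro bounded_linear_intros)
  moreover have "AE t in lebesgue.
      (\<lambda>r. fst (snd (snd r))) (fst (u t) *\<^sub>R field_X (g t) + snd (u t) *\<^sub>R field_Y (g t)) = 0"
    using par by eventually_elim (simp add: field_X_eq field_Y_eq mult.commute)
  ultimately have z: "fst (snd (snd (g t))) = 0" for t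
    using abs_continuous_linear_image[OF ac _ der, of "\<lambda>r. fst (snd (snd r))" 0 t] g0
    by simp
  have "bounded_linear (\<lambda>r :: R5. snd (snd (snd r)))"
    by (intro bounded_linear_intros)
  moreover have "AE t in lebesgue.
      (\<lambda>r. snd (snd (snd r))) (fst (u t) *\<^sub>R field_X (g t) + snd (u t) *\<^sub>R field_Y (g t)) = 0"
    using par
  proof eventually_elim
    case (elim t)
    \<comment> \<open>Once z = 0, the derivatives of v and w are x/12 and y/12 times x u2 - y
      u1.\<close>
    have "fst (g t) * (fst (g t) * snd (u t)) = fst (g t) * (fst (snd (g t)) * fst (u t))"
      "fst (snd (g t)) * (fst (g t) * snd (u t)) = fst (snd (g t)) * (fst (snd (g t)) * fst (u t))"
      by (simp_all only: elim)
    then show ?case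
      by (simp add: field_X_eq field_Y_eq z zero_prod_def power2_eq_square algebra_simps)
  qed
  ultimately have "snd (snd (snd (g t))) = 0"
    using abs_continuous_linear_image[OF ac _ der, of "\<lambda>r. snd (snd (snd r))" 0 t] g0
    by simp
  with line z show ?thesis by (simp add: prod_eq_iff)
qed

section \<open>Constancy of the control\<close>

text \<open>By positive homogeneity a ray carries only one vector with \<open>F = 1\<close>.\<close>

lemma quasinorm_unit_on_ray:
  assumes "quasinorm F" "F (c *\<^sub>R d) = 1" "c \<ge> 0"
  shows "c *\<^sub>R d = (1 / F d) *\<^sub>R d"
proof -
  have "c * F d = 1" using assms by (simp add: quasinorm_scaleR)
  then have "c = 1 / F d" by (metis eq_divide_eq mult_zero_right zero_neq_one)
  then show ?thesis by simp
qed

lemma abnormal_control_const: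
  assumes F: "quasinorm F" and ab: "abnormal_extremal F g u \<psi>" and unit: "arclength_parametrized F u"
    and g0: "g 0 = 0" and \<psi>0: "\<psi> 0 = (\<phi>1, \<phi>2, \<phi>3, \<phi>4, \<phi>5)" and inj: "locally_injective g"
  shows "\<exists>s\<in>{1, -1}. AE t in lebesgue.
    u t = (1 / F (s * \<phi>5, - (s * \<phi>4))) *\<^sub>R (s * \<phi>5, - (s * \<phi>4))"
proof -
  have tr: "trajectory F g u"
    using ab by (simp add: abnormal_extremal_def pontryagin_def)
  note n = abnormal_covector_nonzero[OF F ab unit g0 \<psi>0]
  note orth = abnormal_control_orthogonal[OF F ab unit \<psi>0]
  note line = trajectory_in_line[OF tr g0 n orth]
  define N where "N = \<phi>4\<^sup>2 + \<phi>5\<^sup>2"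
  have N: "N > 0" using n by (simp add: N_def zero_prod_def sum_power2_gt_zero_iff)
  \<comment> \<open>Orthogonal projection onto the line spanned by
    \<open>(\<phi>5, - \<phi>4)\<close>, cleared of the denominator \<open>N\<close>.\<close>
  have decomp: "N *\<^sub>R r = (\<phi>5 * fst r - \<phi>4 * snd r) *\<^sub>R (\<phi>5, - \<phi>4)" if "(\<phi>4, \<phi>5) \<bullet> r = 0" for r
  proof -
    obtain a b where r: "r = (a, b)" by fastforce
    have 0: "\<phi>4 * a + \<phi>5 * b = 0" using that r by simp
    have "N * a = (\<phi>5 * a - \<phi>4 * b) * \<phi>5 + \<phi>4 * (\<phi>4 * a + \<phi>5 * b)"
      "N * b = (\<phi>5 * a - \<phi>4 * b) * - \<phi>4 + \<phi>5 * (\<phi>4 * a + \<phi>5 * b)"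
      by (simp_all add: N_def power2_eq_square algebra_simps)
    then show ?thesis by (simp add: r 0)
  qed
  \<comment> \<open>Up to a constant factor this is the position along the line. It determines
    \<open>g\<close>, so local injectivity passes from \<open>g\<close> to a real function.\<close>
  define \<sigma> where "\<sigma> t = \<phi>5 * fst (g t) - \<phi>4 * fst (snd (g t))" for t
  have \<sigma>_eq: "g r = g t" if "\<sigma> r = \<sigma> t" for r t
  proof -
    have "N *\<^sub>R (fst (g r), fst (snd (g r))) = N *\<^sub>R (fst (g t), fst (snd (g t)))"
      using decomp[of "(fst (g r), fst (snd (g r)))"] decomp[of "(fst (g t), fst (snd (g t)))"]
        line[of r] line[of t] that by (simp add: \<sigma>_def)
    then show ?thesis using N line[of r] line[of t] by (simp add: prod_eq_iff)
  qed
  have "\<exists>e>0. inj_on \<sigma> {t - e<..<t + e}" for t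
    using inj \<sigma>_eq unfolding locally_injective_def inj_on_def by metis
  moreover have "continuous_on UNIV \<sigma>"
    unfolding \<sigma>_def by (intro continuous_intros abnormal_continuous_on[OF ab])
  ultimately have sign: "(\<forall>t D. (\<sigma> has_real_derivative D) (at t) \<longrightarrow> D \<ge> 0) \<or>
      (\<forall>t D. (\<sigma> has_real_derivative D) (at t) \<longrightarrow> D \<le> 0)"
    by (intro locally_inj_derivative_sign)
  have \<sigma>': "AE t in lebesgue. (\<sigma> has_real_derivative \<phi>5 * fst (u t) - \<phi>4 * snd (u t)) (at t)"
    using abnormal_AE_derivatives(1)[OF ab]
  proof eventually_elim
    case (elim t)
    have "bounded_linear (\<lambda>r :: R5. \<phi>5 * fst r - \<phi>4 * fst (snd r))"
      by (intro bounded_linear_intros)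
    from bounded_linear.has_vector_derivative[OF this elim]
    show ?case
      unfolding has_real_derivative_iff_has_vector_derivative \<sigma>_def
      by (simp add: field_X_eq field_Y_eq)
  qed
  \<comment> \<open>The line carries two unit-speed vectors, one on each ray; the sign of the
    component along \<open>(\<phi>5, - \<phi>4)\<close> decides between them.\<close>
  have ray: "r = (1 / F (s * \<phi>5, - (s * \<phi>4))) *\<^sub>R (s * \<phi>5, - (s * \<phi>4))"
    if "F r = 1" "(\<phi>4, \<phi>5) \<bullet> r = 0" "s * (\<phi>5 * fst r - \<phi>4 * snd r) \<ge> 0" "s \<in> {1, -1}" for r s
  proof -
    define c where "c = s * (\<phi>5 * fst r - \<phi>4 * snd r) / N"
    have "c \<ge> 0" using that(3) N by (simp add: c_def)
    have "N *\<^sub>R r = N *\<^sub>R (c *\<^sub>R (s * \<phi>5, - (s * \<phi>4)))"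
      unfolding decomp[OF that(2)] using N that(4) by (auto simp: c_def)
    then have "r = c *\<^sub>R (s * \<phi>5, - (s * \<phi>4))"
      using N unfolding scaleR_cancel_left by simp
    with quasinorm_unit_on_ray[OF F _ \<open>c \<ge> 0\<close>] that(1) show ?thesis by metis
  qed
  \<comment> \<open>The sign is global, so one \<open>s\<close> serves for all times.\<close>
  from sign obtain s :: real where s: "s \<in> {1, -1}"
    "\<And>t D. (\<sigma> has_real_derivative D) (at t) \<Longrightarrow> s * D \<ge> 0"
  proof
    assume "\<forall>t D. (\<sigma> has_real_derivative D) (at t) \<longrightarrow> D \<ge> 0"
    then show thesis by (intro that[of 1]) auto
  next
    assume "\<forall>t D. (\<sigma> has_real_derivative D) (at t) \<longrightarrow> D \<le> 0"
    then show thesis by (intro that[of "-1"]) auto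
  qed
  have "AE t in lebesgue. u t = (1 / F (s * \<phi>5, - (s * \<phi>4))) *\<^sub>R (s * \<phi>5, - (s * \<phi>4))"
    using \<sigma>' orth unit[unfolded arclength_parametrized_def]
  proof eventually_elim
    case (elim t)
    show ?case
      by (rule ray[OF elim(3,2) s(2)[OF elim(1)] s(1)])
  qed
  with s(1) show ?thesis by blast
qed

section \<open>A covector with positive maximum\<close>

text \<open>With last three components zero, the covector \<open>(p, 0)\<close> has Hamiltonian
  \<open>p \<bullet> r\<close> at every point. Its gradient vanishes, so the constant covector
  solves the adjoint equation. Taking \<open>p\<close> to support the unit body at \<open>c\<close>
  gives \<open>M = p \<bullet> c > 0\<close>.\<close>

lemma normal_extremal_if_control_const:
  assumes F: "quasinorm F" and tr: "trajectory F g u" and c: "F c = 1"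
    and u: "AE t in lebesgue. u t = c"
  shows "\<exists>\<psi>. normal_extremal F g u \<psi>"
proof -
  obtain p where p: "p \<bullet> c > 0" "\<And>r. r \<in> unit_body F \<Longrightarrow> p \<bullet> r \<le> p \<bullet> c"
    using unit_body_supporting_functional[OF F c] by metis
  define \<psi> :: "real \<Rightarrow> R5" where "\<psi> t = (fst p, snd p, 0, 0, 0)" for t
  have ham: "hamiltonian (\<psi> t) q r = p \<bullet> r" for t q r
    by (simp add: hamiltonian_def \<psi>_def field_X_eq field_Y_eq inner_prod_def)
  have "hamiltonian_gradient (\<psi> t) q r = 0" for t q r
    by (cases q, cases r) (simp add: \<psi>_def zero_prod_def)
  then have "GDERIV (\<lambda>q. hamiltonian (\<psi> t) q (u t)) (g t) :> 0" for t
    using GDERIV_hamiltonian[of "\<psi> t" "u t" "g t"] by simp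
  moreover have "(\<psi> has_vector_derivative - 0) (at t)" for t
    unfolding \<psi>_def by simp
  ultimately have adj: "\<exists>D. GDERIV (\<lambda>q. hamiltonian (\<psi> t) q (u t)) (g t) :> D \<and>
      (\<psi> has_vector_derivative - D) (at t)" for t by blast
  have "abs_continuous \<psi>"
    by (auto simp: \<psi>_def abs_continuous_def abs_continuous_on_def split_def intro: exI[of _ 1])
  moreover have "\<psi> t \<noteq> 0" for t
    using p(1) by (auto simp: \<psi>_def zero_prod_def inner_prod_def)
  moreover have "AE t in lebesgue. hamiltonian (\<psi> t) (g t) (u t) = p \<bullet> c \<and>
        (\<forall>u'\<in>unit_body F. hamiltonian (\<psi> t) (g t) u' \<le> p \<bullet> c)"
    using u by eventually_elim (simp add: ham p(2))
  ultimately have "pontryagin F g u \<psi> (p \<bullet> c)"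
    using tr adj p(1) by (auto simp: pontryagin_def)
  with p(1) show ?thesis unfolding normal_extremal_def by blast
qed

text \<open>Multiples of one horizontal vector have zero brackets, so the group product reduces to
  addition.\<close>

lemma one_parameter_subgroup_horizontal:
  "one_parameter_subgroup (\<lambda>t. (t * a, t * b, 0, 0, 0))"
  unfolding one_parameter_subgroup_def
  by (auto intro!: continuous_intros simp: cartan_mult_def algebra_simps)

section \<open>Explicit form of the abnormal extremals\<close>

theorem proposition2:
  fixes F :: "R2 \<Rightarrow> real" and g :: "real \<Rightarrow> R5" and u :: "real \<Rightarrow> R2" and \<psi> :: "real \<Rightarrow> R5"
    and \<phi>1 \<phi>2 \<phi>3 \<phi>4 \<phi>5 :: real
  assumes "quasinorm F"
    and "abnormal_extremal F g u \<psi>"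
    and "g 0 = 0"
    and "\<psi> 0 = (\<phi>1, \<phi>2, \<phi>3, \<phi>4, \<phi>5)"
    and "arclength_parametrized F u"
    and "locally_injective g"
  shows "one_parameter_subgroup g \<and>
    (\<exists>s\<in>{1, -1}.
       (\<forall>t. g t = (0, s * t / F (0, s), 0, 0, 0)) \<or>
       (\<forall>t. g t = (s * t / F (s, 0), 0, 0, 0, 0)) \<or>
       (\<phi>4 * \<phi>5 \<noteq> 0 \<and>
        (\<forall>t. let x = s * \<phi>5 * t / F (s * \<phi>5, - (s * \<phi>4))
             in g t = (x, - \<phi>4 * x / \<phi>5, 0, 0, 0)))) \<and>
    \<not> strongly_abnormal F g u"
proof -
  note F = assms(1)
  have tr: "trajectory F g u"
    using assms(2) by (simp add: abnormal_extremal_def pontryagin_def)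
  have n: "(\<phi>4, \<phi>5) \<noteq> 0"
    using abnormal_covector_nonzero[OF assms(1,2,5,3,4)] .
  obtain s where s: "s \<in> {1, -1}" and
    u: "AE t in lebesgue. u t = (1 / F (s * \<phi>5, - (s * \<phi>4))) *\<^sub>R (s * \<phi>5, - (s * \<phi>4))"
    using abnormal_control_const[OF assms(1,2,5,3,4,6)] by blast
  define c where "c = (1 / F (s * \<phi>5, - (s * \<phi>4))) *\<^sub>R (s * \<phi>5, - (s * \<phi>4))"
  have uc: "AE t in lebesgue. u t = c" using u by (simp add: c_def)
  have "F c = 1"
    unfolding c_def using n s by (intro quasinorm_normalize[OF F]) (auto simp: zero_prod_def)
  have g: "g t = (t * fst c, t * snd c, 0, 0, 0)" for t
  proof -
    have ac: "abs_continuous g" and der: "AE t in lebesgue. (g has_vector_derivative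
        fst (u t) *\<^sub>R field_X (g t) + snd (u t) *\<^sub>R field_Y (g t)) (at t)"
      using tr by (simp_all add: trajectory_def)
    have "bounded_linear (\<lambda>r :: R5. (fst r, fst (snd r)))"
      by (intro bounded_linear_intros)
    moreover have "AE t in lebesgue. (\<lambda>r. (fst r, fst (snd r)))
        (fst (u t) *\<^sub>R field_X (g t) + snd (u t) *\<^sub>R field_Y (g t)) = c"
      using uc by eventually_elim (simp add: field_X_eq field_Y_eq)
    ultimately have "(fst (g t), fst (snd (g t))) = t *\<^sub>R c"
      using abs_continuous_linear_image[OF ac _ der, of "\<lambda>r. (fst r, fst (snd r))" c t] assms(3)
      by (simp add: zero_prod_def)
    moreover have "snd (snd (g t)) = 0"
      using trajectory_in_line[OF tr assms(3) n abnormal_control_orthogonal[OF assms(1,2,5,4)]] by simp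
    ultimately show ?thesis by (simp add: prod_eq_iff)
  qed
  have "one_parameter_subgroup g"
    using one_parameter_subgroup_horizontal[of "fst c" "snd c"] g by (simp add: one_parameter_subgroup_def)
  moreover have "\<exists>s\<in>{1, -1}.
       (\<forall>t. g t = (0, s * t / F (0, s), 0, 0, 0)) \<or>
       (\<forall>t. g t = (s * t / F (s, 0), 0, 0, 0, 0)) \<or>
       (\<phi>4 * \<phi>5 \<noteq> 0 \<and>
        (\<forall>t. let x = s * \<phi>5 * t / F (s * \<phi>5, - (s * \<phi>4))
             in g t = (x, - \<phi>4 * x / \<phi>5, 0, 0, 0)))"
  proof -
    \<comment> \<open>Positive homogeneity scales a direction along an axis to the unit vector of
      the same sign; without symmetry of \<open>F\<close> the sign must be kept.\<close>
    have sgn: "r / F (0, r) = sgn r / F (0, sgn r)" "r / F (r, 0) = sgn r / F (sgn r, 0)"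
      "sgn r \<in> {1, -1}" if "r \<noteq> 0" for r
    proof -
      have "F (0, r) = \<bar>r\<bar> * F (0, sgn r)" "F (r, 0) = \<bar>r\<bar> * F (sgn r, 0)"
        using quasinorm_scaleR[OF F, of "\<bar>r\<bar>" "(0, sgn r)"]
          quasinorm_scaleR[OF F, of "\<bar>r\<bar>" "(sgn r, 0)"] by (simp_all add: abs_mult_sgn)
      then show "r / F (0, r) = sgn r / F (0, sgn r)" "r / F (r, 0) = sgn r / F (sgn r, 0)"
        using that by (auto simp: sgn_if)
      show "sgn r \<in> {1, -1}" using that by (simp add: sgn_if)
    qed
    consider "\<phi>5 = 0" "\<phi>4 \<noteq> 0" | "\<phi>4 = 0" "\<phi>5 \<noteq> 0" | "\<phi>4 * \<phi>5 \<noteq> 0"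
      using n by (auto simp: zero_prod_def)
    then show ?thesis
    proof cases
      case 1
      \<comment> \<open>The direction is \<open>(0, - (s * \<phi>4))\<close>, so the sign in the
        first family is that of \<open>r\<close> and may differ from \<open>s\<close>.\<close>
      define r where "r = - (s * \<phi>4)"
      have "r \<noteq> 0" using 1 s by (auto simp: r_def)
      then have "g t = (0, sgn r * t / F (0, sgn r), 0, 0, 0)" for t
        using sgn(1)[of r] 1 by (simp add: g c_def r_def mult.commute)
      with sgn(3)[OF \<open>r \<noteq> 0\<close>] show ?thesis by blast
    next
      case 2
      define r where "r = s * \<phi>5"
      have "r \<noteq> 0" using 2 s by (auto simp: r_def)
      then have "g t = (sgn r * t / F (sgn r, 0), 0, 0, 0, 0)" for t
        using sgn(2)[of r] 2 by (simp add: g c_def r_def mult.commute)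
      with sgn(3)[OF \<open>r \<noteq> 0\<close>] show ?thesis by blast
    next
      case 3
      then have "\<forall>t. let x = s * \<phi>5 * t / F (s * \<phi>5, - (s * \<phi>4))
             in g t = (x, - \<phi>4 * x / \<phi>5, 0, 0, 0)"
        by (simp add: g c_def Let_def field_simps)
      with 3 s show ?thesis by blast
    qed
  qed
  moreover have "\<not> strongly_abnormal F g u"
    using normal_extremal_if_control_const[OF F tr \<open>F c = 1\<close> uc] by (simp add: strongly_abnormal_def)
  ultimately show ?thesis by blast
qed

end
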